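(* Let $M$ be a noetherian gcd-monoid satisfying the $3$-Ore condition, and let $n\ge 4$ be even. Then every unital $n$-multifraction $\underline a=a_1/\cdots/a_n$ on $M$ (that is, $a_1,\dots,a_n\in M$ with $\iota(a_1)\iota(a_2)^{-1}\iota(a_3)\cdots\iota(a_n)^{-1}=1$ in $U(M)$) admits a van Kampen diagram of shape $\Gamma_n$.
   Context: A gcd-monoid is a cancellative monoid with no nontrivial invertible element in which any two elements admit a left gcd and a right gcd (greatest lower bounds for left divisibility, $a$ left divides $ax$, and right divisibility, $a$ right divides $xa$). It is noetherian if the proper left and proper right divisibility relations are both well-founded. $3$-Ore condition: any three elements that pairwise admit a common right (resp. left) multiple admit a global common right (resp. left) multiple (both versions are required). $U(M)$ is the enveloping (universal) group of $M$ and $\iota:M\to U(M)$ the canonical morphism. The graphs $\Gamma_n$ ($n\ge4$ even): $\Gamma_n$ is a finite planar oriented graph with base vertex $*$ and outer boundary an $n$-cycle $u_0=*,u_1,\dots,u_{n-1}$ whose edges go from even-indexed to odd-indexed vertices: $u_0\to u_1\leftarrow u_2\to u_3\leftarrow\cdots\to u_{n-1}\leftarrow u_0$. - $\Gamma_4$ has vertices $u_0=*,u_1,u_2,u_3$ and a centre $x$, with edges $u_0\to u_1$, $u_2\to u_1$, $u_2\to u_3$, $u_0\to u_3$, $u_0\to x$, $u_2\to x$, $x\to u_1$, $x\to u_3$; it has four triangles, namely $s\to x\to t$ together with $s\to t$ for $s\in\{u_0,u_2\}$, $t\in\{u_1,u_3\}$. - For $n\ge6$, $\Gamma_n$ is obtained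 from $\Gamma_{n-2}$, whose outer boundary vertices are denoted $v_0=*,v_1,\dots,v_{n-3}$, by adding new vertices $u_1,\dots,u_{n-1}$ (with $u_0=v_0=*$) and attaching $n-2$ adjacent copies of $\Gamma_4$ around it: writing $v_{n-2}:=v_0=*$, for $k=1,\dots,n-2$ the $k$th copy has a new centre $x_k$ and the four corners $u_k,u_{k+1},v_k,v_{k-1}$ (cyclically); its edges go from each of the two even-indexed corners to each of the two odd-indexed corners, from each even-indexed corner to $x_k$, and from $x_k$ to each odd-indexed corner. Common edges of adjacent copies and of copies and $\Gamma_{n-2}$ are identified. The triangles of $\Gamma_n$ are those of all its copies of $\Gamma_4$. An $n$-multifraction $a_1/\cdots/a_n$ on $M$ admits a van Kampen diagram of shape $\Gamma_n$ if there is a labeling of the edges of $\Gamma_n$ by elements of $M$ such that the outer labels from $*$ are $a_1,\dots,a_n$ (the edge between $u_{i-1}$ and $u_i$ has label $a_i$ for $1\le i\le n$, with $u_n=u_0$) and the labels in each triangle induce an equality in $M$: for each triangle $s\to x\to t$, $s\to t$, the label of $s\to t$ equals the product of the label of $s\to x$ by the label of $x\to t$. *)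

theory Defs
  imports Main "HOL-Library.FuncSet"
begin

section \<open>Gcd-monoids\<close>

definition (in monoid_mult) left_dvd :: "'a \<Rightarrow> 'a \<Rightarrow> bool" where
  "left_dvd a b \<longleftrightarrow> (\<exists>x. b = a * x)"

definition (in monoid_mult) right_dvd :: "'a \<Rightarrow> 'a \<Rightarrow> bool" where
  "right_dvd a b \<longleftrightarrow> (\<exists>x. b = x * a)"

definition (in monoid_mult) is_left_gcd :: "'a \<Rightarrow> 'a \<Rightarrow> 'a \<Rightarrow> bool" where
  "is_left_gcd d a b \<longleftrightarrow> left_dvd d a \<and> left_dvd d b \<and>
     (\<forall>c. left_dvd c a \<and> left_dvd c b \<longrightarrow> left_dvd c d)"

definition (in monoid_mult) is_right_gcd :: "'a \<Rightarrow> 'a \<Rightarrow> 'a \<Rightarrow> bool" where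
  "is_right_gcd d a b \<longleftrightarrow> right_dvd d a \<and> right_dvd d b \<and>
     (\<forall>c. right_dvd c a \<and> right_dvd c b \<longrightarrow> right_dvd c d)"

class gcd_monoid = monoid_mult +
  assumes mult_left_cancel: "a * b = a * c \<Longrightarrow> b = c"
    and mult_right_cancel: "b * a = c * a \<Longrightarrow> b = c"
    and invertible_trivial: "a * b = 1 \<Longrightarrow> b * a = 1 \<Longrightarrow> a = 1"
    and left_gcd_exists: "\<exists>d. is_left_gcd d a b"
    and right_gcd_exists: "\<exists>d. is_right_gcd d a b"

text \<open>
  Properness means that the cofactor is not invertible; in a gcd-monoid the only
  invertible element is \<open>1\<close>.
\<close>

definition proper_left_dvd :: "'a::gcd_monoid \<Rightarrow> 'a \<Rightarrow> bool" where
  "proper_left_dvd a b \<longleftrightarrow> (\<exists>x. x \<noteq> 1 \<and> b = a * x)"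

definition proper_right_dvd :: "'a::gcd_monoid \<Rightarrow> 'a \<Rightarrow> bool" where
  "proper_right_dvd a b \<longleftrightarrow> (\<exists>x. x \<noteq> 1 \<and> b = x * a)"

definition noetherian :: "'a::gcd_monoid itself \<Rightarrow> bool" where
  "noetherian _ \<longleftrightarrow>
     wfp (proper_left_dvd :: 'a \<Rightarrow> 'a \<Rightarrow> bool) \<and> wfp (proper_right_dvd :: 'a \<Rightarrow> 'a \<Rightarrow> bool)"

text \<open>A common right multiple of \<open>A\<close> is an element left divisible by all members of \<open>A\<close>.\<close>

definition has_common_right_multiple :: "'a::monoid_mult set \<Rightarrow> bool" where
  "has_common_right_multiple A \<longleftrightarrow> (\<exists>m. \<forall>a\<in>A. left_dvd a m)"

definition has_common_left_multiple :: "'a::monoid_mult set \<Rightarrow> bool" where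
  "has_common_left_multiple A \<longleftrightarrow> (\<exists>m. \<forall>a\<in>A. right_dvd a m)"

definition three_Ore :: "'a::monoid_mult itself \<Rightarrow> bool" where
  "three_Ore _ \<longleftrightarrow>
     (\<forall>a b c :: 'a.
        has_common_right_multiple {a, b} \<and> has_common_right_multiple {b, c} \<and>
        has_common_right_multiple {a, c} \<longrightarrow> has_common_right_multiple {a, b, c}) \<and>
     (\<forall>a b c :: 'a.
        has_common_left_multiple {a, b} \<and> has_common_left_multiple {b, c} \<and>
        has_common_left_multiple {a, c} \<longrightarrow> has_common_left_multiple {a, b, c})"


section \<open>The enveloping group of a monoid\<close>

text \<open>
  Signed words over the monoid, \<open>(a, True)\<close> standing for \<open>a\<close> and \<open>(a, False)\<close> for the formal
  inverse of \<open>a\<close>, modulo the congruence that presents the enveloping group.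
\<close>

inductive env_eq :: "('a::monoid_mult \<times> bool) list \<Rightarrow> ('a \<times> bool) list \<Rightarrow> bool" where
  env_refl: "env_eq w w"
| env_sym: "env_eq v w \<Longrightarrow> env_eq w v"
| env_trans: "env_eq u v \<Longrightarrow> env_eq v w \<Longrightarrow> env_eq u w"
| env_append: "env_eq v v' \<Longrightarrow> env_eq w w' \<Longrightarrow> env_eq (v @ w) (v' @ w')"
| env_one: "env_eq [(1, True)] []"
| env_mult: "env_eq [(a, True), (b, True)] [(a * b, True)]"
| env_right_inverse: "env_eq [(a, True), (a, False)] []"
| env_left_inverse: "env_eq [(a, False), (a, True)] []"

quotient_type (overloaded) 'a enveloping_group = "('a::monoid_mult \<times> bool) list" / env_eq
  by (rule equivpI) (auto intro: reflpI sympI transpI env_refl env_sym env_trans)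

definition word_inverse :: "('a \<times> bool) list \<Rightarrow> ('a \<times> bool) list" where
  "word_inverse w = rev (map (\<lambda>(a, s). (a, \<not> s)) w)"

lemma word_inverse_append: "word_inverse (v @ w) = word_inverse w @ word_inverse v"
  by (simp add: word_inverse_def)

lemma word_inverse_Cons: "word_inverse (p # w) = word_inverse w @ [(fst p, \<not> snd p)]"
  by (simp add: word_inverse_def case_prod_beta)

lemma word_inverse_idem: "word_inverse (word_inverse w) = w"
  by (induction w) (simp_all add: word_inverse_def rev_map case_prod_beta)

lemma env_eq_left_inverse: "env_eq (word_inverse w @ w) []"
proof (induction w)
  case Nil
  show ?case by (simp add: word_inverse_def env_refl)
next
  case (Cons p w)
  have p: "env_eq [(fst p, \<not> snd p), p] []"
    by (cases p; cases "snd p") (auto intro: env_left_inverse env_right_inverse)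
  have "env_eq (word_inverse w @ ([(fst p, \<not> snd p), p] @ w)) (word_inverse w @ ([] @ w))"
    by (intro env_append env_refl p)
  then have "env_eq (word_inverse (p # w) @ p # w) (word_inverse w @ w)"
    by (simp add: word_inverse_Cons)
  then show ?case using Cons.IH by (rule env_trans)
qed

lemma env_eq_word_inverse: 
  assumes "env_eq v w"
  shows "env_eq (word_inverse v) (word_inverse w)"
proof -
  have v: "env_eq (v @ word_inverse v) []"
    using env_eq_left_inverse[of "word_inverse v"] by (simp add: word_inverse_idem)
  have "env_eq (word_inverse w @ v @ word_inverse v) (word_inverse w @ [])"
    by (intro env_append env_refl v)
  moreover have "env_eq ((word_inverse w @ v) @ word_inverse v) ([] @ word_inverse v)"
    by (intro env_append env_refl)
       (metis assms env_append env_eq_left_inverse env_refl env_trans)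
  ultimately show ?thesis
    by (metis append.assoc append_Nil append_Nil2 env_sym env_trans)
qed

instantiation enveloping_group :: (monoid_mult) "{monoid_mult, inverse}"
begin

lift_definition one_enveloping_group :: "'a enveloping_group" is "[]" .

lift_definition times_enveloping_group ::
  "'a enveloping_group \<Rightarrow> 'a enveloping_group \<Rightarrow> 'a enveloping_group" is "(@)"
  by (rule env_append)

lift_definition inverse_enveloping_group :: "'a enveloping_group \<Rightarrow> 'a enveloping_group"
  is word_inverse
  by (rule env_eq_word_inverse)

definition divide_enveloping_group ::
  "'a enveloping_group \<Rightarrow> 'a enveloping_group \<Rightarrow> 'a enveloping_group" where
  "divide_enveloping_group x y = x * inverse y"

instance
  by standard (transfer; simp add: env_refl)+

end

lift_definition \<iota> :: "'a::monoid_mult \<Rightarrow> 'a enveloping_group" is "\<lambda>a. [(a, True)]" .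

lemma enveloping_group_left_inverse:
  "inverse x * x = (1 :: 'a::monoid_mult enveloping_group)"
  by transfer (rule env_eq_left_inverse)

lemma group_enveloping_group:
  "Groups.group (*) 1 (inverse :: 'a::monoid_mult enveloping_group \<Rightarrow> 'a enveloping_group)"
  by unfold_locales (simp_all add: mult.assoc enveloping_group_left_inverse)

lemma \<iota>_one: "\<iota> 1 = 1"
  by transfer (rule env_one)

lemma \<iota>_mult: "\<iota> (a * b) = \<iota> a * \<iota> b"
  by transfer (auto intro: env_sym env_mult)

lemma inverse_\<iota>_abs: "inverse (\<iota> a) = abs_enveloping_group [(a, False)]"
  by (simp add: \<iota>.abs_eq inverse_enveloping_group.abs_eq word_inverse_def)

theorem enveloping_group_universal:
  fixes f :: "'g \<Rightarrow> 'g \<Rightarrow> 'g" and h :: "'a::monoid_mult \<Rightarrow> 'g"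
  assumes "Groups.group f e i"
    and h_one: "h 1 = e" and h_mult: "\<And>a b. h (a * b) = f (h a) (h b)"
  shows "\<exists>!g. g 1 = e \<and> (\<forall>x y. g (x * y) = f (g x) (g y)) \<and> (\<forall>a. g (\<iota> a) = h a)"
proof -
  interpret G: Groups.group f e i by fact
  define ev where "ev w = foldr (\<lambda>(a, s) r. f (if s then h a else i (h a)) r) w e" for w
  have ev_Cons: "ev (p # w) = f (if snd p then h (fst p) else i (h (fst p))) (ev w)" for p w
    by (simp add: ev_def case_prod_beta)
  have ev_Nil: "ev [] = e" by (simp add: ev_def)
  have ev_append: "ev (v @ w) = f (ev v) (ev w)" for v w
    by (induction v) (simp_all add: ev_Cons ev_Nil G.assoc)
  have ev_resp: "ev v = ev w" if "env_eq v w" for v w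
    using that
    by induction (simp_all add: ev_append ev_Cons ev_Nil h_one h_mult)
  define g where "g x = ev (rep_enveloping_group x)" for x
  have g_abs: "g (abs_enveloping_group w) = ev w" for w
    unfolding g_def
    by (rule ev_resp) (simp add: Quotient3_enveloping_group rep_abs_rsp_left env_refl)
  have g_mult: "g (x * y) = f (g x) (g y)" for x y
    by (induction x; induction y) (simp add: times_enveloping_group.abs_eq g_abs ev_append)
  show ?thesis
  proof (rule ex1I[of _ g])
    show "g 1 = e \<and> (\<forall>x y. g (x * y) = f (g x) (g y)) \<and> (\<forall>a. g (\<iota> a) = h a)"
      by (simp add: g_mult one_enveloping_group.abs_eq \<iota>.abs_eq g_abs ev_Nil ev_Cons)
  next
    fix k
    assume k: "k 1 = e \<and> (\<forall>x y. k (x * y) = f (k x) (k y)) \<and> (\<forall>a. k (\<iota> a) = h a)"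
    have k_inv: "k (inverse x) = i (k x)" for x
      using k enveloping_group_left_inverse[of x] by (metis G.inverse_unique G.inverse_inverse)
    have "k (abs_enveloping_group w) = ev w" for w
    proof (induction w)
      case Nil
      then show ?case using k by (simp add: ev_Nil one_enveloping_group.abs_eq[symmetric])
    next
      case (Cons p w)
      have p: "k (abs_enveloping_group [p]) = (if snd p then h (fst p) else i (h (fst p)))"
        using k k_inv by (cases p) (auto simp: \<iota>.abs_eq[symmetric] inverse_\<iota>_abs[symmetric])
      have "abs_enveloping_group (p # w) = abs_enveloping_group [p] * abs_enveloping_group w"
        by (simp add: times_enveloping_group.abs_eq)
      then show ?case using k p Cons.IH by (simp add: ev_Cons)
    qed
    then have "k x = g x" for x
      by (induction x) (simp add: g_abs)
    then show "k = g" by (rule ext)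
  qed
qed

text \<open>
  A multifraction \<open>a\<^sub>1 / \<dots> / a\<^sub>n\<close> is the list of its entries; the 0-based entry \<open>a ! j\<close> is
  \<open>a\<^bsub>j+1\<^esub>\<close>, so it counts positively iff \<open>j\<close> is even.
\<close>

definition unital :: "'a::monoid_mult list \<Rightarrow> bool" where
  "unital a \<longleftrightarrow>
     prod_list (map (\<lambda>j. if even j then \<iota> (a ! j) else inverse (\<iota> (a ! j))) [0..<length a]) = 1"


section \<open>The graphs \<open>\<Gamma>\<^sub>n\<close>\<close>

text \<open>
  \<open>Outer n i\<close> is the vertex \<open>u\<^sub>i\<close> (\<open>0 < i < n\<close>) on the outer boundary of \<open>\<Gamma>\<^sub>n\<close>, and \<open>Centre n k\<close>
  the centre of the \<open>k\<close>th copy of \<open>\<Gamma>\<^sub>4\<close> added when passing from \<open>\<Gamma>\<^bsub>n-2\<^esub>\<close> to \<open>\<Gamma>\<^sub>n\<close>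
  (\<open>Centre 4 1\<close> is the centre of the initial \<open>\<Gamma>\<^sub>4\<close>). Sharing these names between the
  successive graphs realizes all identifications.
\<close>

datatype vertex = Base | Outer nat nat | Centre nat nat

text \<open>Indices are cyclic, so that \<open>u\<^sub>n = u\<^sub>0\<close>, and all boundaries pass through \<open>Base\<close>.\<close>

definition boundary :: "nat \<Rightarrow> nat \<Rightarrow> vertex" where
  "boundary n i = (if i mod n = 0 then Base else Outer n i)"

text \<open>
  A copy of \<open>\<Gamma>\<^sub>4\<close> is encoded as \<open>(S, x, T)\<close>: its even-indexed corners, its centre and its
  odd-indexed corners.
\<close>

type_synonym diamond = "vertex set \<times> vertex \<times> vertex set"

definition attached_diamond :: "nat \<Rightarrow> nat \<Rightarrow> diamond" where
  "attached_diamond n k =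
     (let u = boundary n; v = boundary (n - 2) in
      if even k then ({u k, v k}, Centre n k, {u (k + 1), v (k - 1)})
      else ({u (k + 1), v (k - 1)}, Centre n k, {u k, v k}))"

text \<open>Only even \<open>n \<ge> 4\<close> is meaningful: for odd \<open>n\<close> the value is irrelevant.\<close>

fun diamonds :: "nat \<Rightarrow> diamond set" where
  "diamonds n =
     (if n < 4 then {}
      else if n = 4 then
        {({boundary 4 0, boundary 4 2}, Centre 4 1, {boundary 4 1, boundary 4 3})}
      else diamonds (n - 2) \<union> attached_diamond n ` {1..n - 2})"

declare diamonds.simps [simp del]

definition arcs :: "nat \<Rightarrow> (vertex \<times> vertex) set" where
  "arcs n = (\<Union>(S, x, T)\<in>diamonds n. S \<times> T \<union> S \<times> {x} \<union> {x} \<times> T)"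

text \<open>\<open>(s, x, t)\<close> is the triangle with sides \<open>s \<rightarrow> x\<close>, \<open>x \<rightarrow> t\<close> and \<open>s \<rightarrow> t\<close>.\<close>

definition triangles :: "nat \<Rightarrow> (vertex \<times> vertex \<times> vertex) set" where
  "triangles n = (\<Union>(S, x, T)\<in>diamonds n. S \<times> {x} \<times> T)"

definition boundary_arc :: "nat \<Rightarrow> nat \<Rightarrow> vertex \<times> vertex" where
  "boundary_arc n i =
     (if odd i then (boundary n (i - 1), boundary n i) else (boundary n i, boundary n (i - 1)))"

text \<open>Labelings are functions on \<open>arcs n\<close>, made unique by \<open>undefined\<close> elsewhere.\<close>

definition van_kampen_diagram ::
  "nat \<Rightarrow> 'a::monoid_mult list \<Rightarrow> (vertex \<times> vertex \<Rightarrow> 'a) \<Rightarrow> bool" where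
  "van_kampen_diagram n a l \<longleftrightarrow>
     l \<in> arcs n \<rightarrow>\<^sub>E UNIV \<and>
     (\<forall>i\<in>{1..n}. l (boundary_arc n i) = a ! (i - 1)) \<and>
     (\<forall>(s, x, t)\<in>triangles n. l (s, t) = l (s, x) * l (x, t))"

definition admits_van_kampen_diagram :: "nat \<Rightarrow> 'a::monoid_mult list \<Rightarrow> bool" where
  "admits_van_kampen_diagram n a \<longleftrightarrow> (\<exists>l. van_kampen_diagram n a l)"

end

theory Submission imports Defs begin

text \<open>
  Order the enveloping group by \<open>g \<le> g x\<close> for \<open>x\<close> in the monoid. A van Kampen diagram amounts to
  a placement of its vertices in this order with \<open>s \<le> x \<le> t\<close> in each triangle, and a unital
  multifraction to a closed zigzag through \<open>1\<close>. Let \<open>Z\<^sub>k\<close> be the set of endpoints of zigzags of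
  length \<open>k\<close> from \<open>1\<close>. The key fact is that for even \<open>k\<close>, two elements of \<open>Z\<^sub>k\<close> with a common
  upper bound have one in \<open>Z\<^bsub>k-1\<^esub>\<close>, and dually for odd \<open>k\<close>. It allows one to walk from the
  vertex \<open>u\<^bsub>n/2-1\<^esub>\<close> of the outer zigzag back to \<open>1\<close> on both sides, at distance one from that
  zigzag, which yields the inner zigzag. Each diamond then has a
  centre, by the description below of equality for zigzags of length \<open>2\<close>, after translation.

  The key fact is immediate if equality of endpoints of zigzags is generated by moving factors
  between consecutive entries. This holds because the sets of zigzags modulo this relation, built
  one entry at a time, remain a free partial action of the monoid (this is where the 3-Ore
  condition enters), so that the enveloping group acts on their union.
\<close>

section \<open>Sided multiplication and lcms\<close>

text \<open>The flag \<open>s\<close> selects the side of multiplication, so that each argument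
  yields its mirror image; \<open>\<not> s\<close> amounts to the opposite monoid.\<close>

definition smul :: "bool \<Rightarrow> 'a::monoid_mult \<Rightarrow> 'a \<Rightarrow> 'a" where
  "smul s a b = (if s then a * b else b * a)"

lemma smul_assoc: "smul s (smul s a b) c = smul s a (smul s b c)"
  by (simp add: smul_def mult.assoc)

lemma smul_one [simp]: "smul s 1 a = a" "smul s a 1 = a"
  by (simp_all add: smul_def)

lemma smul_flip: "smul (\<not> s) a b = smul s b a"
  by (simp add: smul_def)

lemma smul_left_cancel [simp]: "smul s a b = smul s a c \<longleftrightarrow> b = (c :: 'a::gcd_monoid)"
  by (auto simp: smul_def dest: mult_left_cancel mult_right_cancel)

lemma smul_right_cancel [simp]: "smul s b a = smul s c a \<longleftrightarrow> b = (c :: 'a::gcd_monoid)"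
  by (auto simp: smul_def dest: mult_left_cancel mult_right_cancel)

lemma smul_eq_one_iff [simp]: "smul s a b = 1 \<longleftrightarrow> a = 1 \<and> b = (1 :: 'a::gcd_monoid)"
proof -
  have "a = 1 \<and> b = 1" if "a * b = 1" for a b :: 'a
  proof -
    have "b * (a * b) = b * 1"
      using that by simp
    then have "(b * a) * b = 1 * b"
      by (simp add: mult.assoc)
    then have "b * a = 1"
      by (rule mult_right_cancel)
    then show ?thesis
      using that invertible_trivial by metis
  qed
  from this[of a b] this[of b a] show ?thesis
    unfolding smul_def by (metis mult_1)
qed

lemma smul_gcd:
  fixes a b :: "'a::gcd_monoid"
  obtains d a' b' where "a = smul s d a'" "b = smul s d b'"
    "\<And>c x y. a = smul s c x \<Longrightarrow> b = smul s c y \<Longrightarrow> \<exists>z. d = smul s c z"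
proof (cases s)
  case True
  obtain d where "is_left_gcd d a b"
    using left_gcd_exists by blast
  then show ?thesis
    using True that[of d] unfolding is_left_gcd_def left_dvd_def smul_def by auto blast
next
  case False
  obtain d where "is_right_gcd d a b"
    using right_gcd_exists by blast
  then show ?thesis
    using False that[of d] unfolding is_right_gcd_def right_dvd_def smul_def by auto blast
qed

text \<open>Cancelling the gcd \<open>g\<close> of the two cofactors, taken on the other side, turns
  any common multiple into a least one: the remaining cofactors \<open>u\<close>, \<open>v\<close>
  are coprime.\<close>

lemma smul_lcm:
  fixes a b :: "'a::gcd_monoid"
  assumes "smul s a x = smul s b y"
  obtains u v where "smul s a u = smul s b v"
    "\<And>x y. smul s a x = smul s b y \<Longrightarrow> \<exists>w. x = smul s u w \<and> y = smul s v w"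
proof -
  obtain g u v where g: "x = smul s u g" "y = smul s v g"
    and gmax: "\<And>c p q. x = smul s p c \<Longrightarrow> y = smul s q c \<Longrightarrow> \<exists>z. g = smul s z c"
    using smul_gcd[of x "\<not> s" y] unfolding smul_flip by metis
  have uv: "smul s a u = smul s b v"
    using assms by (simp add: g flip: smul_assoc)
  have coprime: "c = 1" if "u = smul s p c" "v = smul s q c" for c p q
  proof -
    have "x = smul s p (smul s c g)" "y = smul s q (smul s c g)"
      using g that by (simp_all flip: smul_assoc)
    then obtain z where "g = smul s z (smul s c g)"
      using gmax by blast
    then have "smul s 1 g = smul s (smul s z c) g"
      by (metis smul_assoc smul_one(1))
    then have "smul s z c = 1"
      unfolding smul_right_cancel by simp
    then show ?thesis
      by simp
  qed
  have "\<exists>w. x' = smul s u w \<and> y' = smul s v w" if xy: "smul s a x' = smul s b y'" for x' y'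
  proof -
    \<comment> \<open>The gcd \<open>d\<close> of the candidate and another common multiple is
      itself a multiple of \<open>a\<close> and of \<open>b\<close>, so \<open>p\<close> divides
      both \<open>u\<close> and \<open>v\<close>, hence is 1.\<close>
    obtain d p q where d: "smul s a u = smul s d p" "smul s a x' = smul s d q"
      and dmax: "\<And>c p q. smul s a u = smul s c p \<Longrightarrow> smul s a x' = smul s c q
        \<Longrightarrow> \<exists>z. d = smul s c z"
      using smul_gcd[of "smul s a u" s "smul s a x'"] by metis
    obtain u' where u': "d = smul s a u'"
      using dmax by blast
    obtain v' where v': "d = smul s b v'"
      using dmax uv xy by metis
    have "u = smul s u' p"
      using d(1) by (simp add: u' smul_assoc)
    moreover have "v = smul s v' p"
      using d(1) by (simp add: uv v' smul_assoc)
    ultimately have "p = 1"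
      by (rule coprime)
    then have "smul s a x' = smul s a (smul s u q)" "smul s b y' = smul s b (smul s v q)"
      using d xy uv by (simp_all flip: smul_assoc)
    then show ?thesis
      by auto
  qed
  then show ?thesis
    using that uv by blast
qed

text \<open>Here \<open>a\<close>, \<open>b\<close>, \<open>c\<close> are second factors, so
  \<open>s = True\<close> calls for the half of the condition about left multiples.\<close>

lemma smul_three_Ore:
  fixes a b c :: "'a::gcd_monoid"
  assumes "three_Ore TYPE('a)"
    and "smul s x a = smul s y b" "smul s x' b = smul s y' c" "smul s x'' a = smul s y'' c"
  obtains p q r where "smul s p a = smul s q b" "smul s p a = smul s r c"
proof (cases s)
  case True
  have "has_common_left_multiple {a, b} \<and> has_common_left_multiple {b, c} \<and>
    has_common_left_multiple {a, c}"
    using assms(2-) True by (simp add: smul_def has_common_left_multiple_def right_dvd_def) metis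
  then have "has_common_left_multiple {a, b, c}"
    by (rule assms(1)[unfolded three_Ore_def, THEN conjunct2, rule_format])
  then show ?thesis
    using that True unfolding smul_def has_common_left_multiple_def right_dvd_def
    by simp metis
next
  case False
  have "has_common_right_multiple {a, b} \<and> has_common_right_multiple {b, c} \<and>
    has_common_right_multiple {a, c}"
    using assms(2-) False by (simp add: smul_def has_common_right_multiple_def left_dvd_def) metis
  then have "has_common_right_multiple {a, b, c}"
    by (rule assms(1)[unfolded three_Ore_def, THEN conjunct1, rule_format])
  then show ?thesis
    using that False unfolding smul_def has_common_right_multiple_def left_dvd_def
    by simp metis
qed

section \<open>Layers\<close>

text \<open>\<open>R p x q\<close> is to be read as \<open>q = p x\<close>; equality of points is \<open>R p 1 q\<close>.\<close>

locale layer =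
  fixes s :: bool and R :: "'p \<Rightarrow> 'a::gcd_monoid \<Rightarrow> 'p \<Rightarrow> bool"
  assumes refl: "R p 1 p"
    and sym: "R p 1 q \<Longrightarrow> R q 1 p"
    and comp: "R p x q \<Longrightarrow> R q y r \<Longrightarrow> R p (smul s x y) r"
    and decomp: "R p (smul s x y) r \<Longrightarrow> \<exists>q. R p x q \<and> R q y r"
    and free: "R p x q \<Longrightarrow> R p y q \<Longrightarrow> x = y"
    and target_unique: "R p x q \<Longrightarrow> R p x q' \<Longrightarrow> R q 1 q'"
    and source_unique: "R p x q \<Longrightarrow> R p' x q \<Longrightarrow> R p 1 p'"
begin

abbreviation sided_mult (infixl "\<cdot>" 70) where "a \<cdot> b \<equiv> smul s a b"

lemma cong_source: "R p 1 p' \<Longrightarrow> R p x q \<Longrightarrow> R p' x q"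
  using comp[of p' 1 p x q] sym by simp

lemma cong_target: "R q 1 q' \<Longrightarrow> R p x q \<Longrightarrow> R p x q'"
  using comp[of p x q 1 q'] by simp

text \<open>Reversing arrows changes sides; signs alternate along a zigzag, so each layer extends
  the reverse of the previous one.\<close>

lemma dual: "layer (\<not> s) (\<lambda>p x q. R q x p)"
  by unfold_locales
    (auto simp: smul_flip intro: refl sym comp free target_unique source_unique dest: decomp)

end

text \<open>
  The extension adjoins all formal products \<open>f (f k)\<close>, with \<open>f\<close> a point of \<open>R\<close>; two of them agree
  if they agree after moving a part of the last factor into \<open>R\<close>.
\<close>

definition extension ::
  "bool \<Rightarrow> nat \<Rightarrow> ((nat \<Rightarrow> 'a::gcd_monoid) \<Rightarrow> 'a \<Rightarrow> (nat \<Rightarrow> 'a) \<Rightarrow> bool) \<Rightarrow>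
    (nat \<Rightarrow> 'a) \<Rightarrow> 'a \<Rightarrow> (nat \<Rightarrow> 'a) \<Rightarrow> bool" where
  "extension s k R f y g \<longleftrightarrow>
     (\<exists>q x x' d. R f x q \<and> R g x' q \<and> smul s (f k) y = smul s x d \<and> g k = smul s x' d)"

text \<open>The axiom \<open>closed\<close> is what makes the lcm of two elements act on
  \<open>p\<close> as soon as both act on \<open>p\<close> and have a common multiple.\<close>

locale closed_layer = layer s R for s and R :: "(nat \<Rightarrow> 'a::gcd_monoid) \<Rightarrow> 'a \<Rightarrow> (nat \<Rightarrow> 'a) \<Rightarrow> bool" +
  fixes k :: nat
  assumes local: "(\<And>i. i < k \<Longrightarrow> f i = f' i) \<Longrightarrow> R f 1 f'"
    and closed: "R p x q \<Longrightarrow> R p y q' \<Longrightarrow> smul s x a = smul s y b \<Longrightarrow>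
      \<exists>c d r. R p (smul s x c) r \<and> smul s x c = smul s y d"
begin

abbreviation E where "E \<equiv> extension s k R"

lemma upd: "R (f(k := c)) 1 f" "R f 1 (f(k := c))"
  by (rule local; simp)+

text \<open>Some common multiple of \<open>x\<close> and \<open>w\<close> acts on \<open>p\<close>
  by \<open>closed\<close>; the lcm divides it, so it acts too by \<open>decomp\<close>. Thus two
  ways of moving factors at a shared point can be merged.\<close>

lemma join:
  assumes "R p x q" "R p w r" "x \<cdot> d = w \<cdot> e"
  obtains \<alpha> \<beta> \<gamma> t where "R q \<alpha> t" "R r \<beta> t" "d = \<alpha> \<cdot> \<gamma>" "e = \<beta> \<cdot> \<gamma>" "x \<cdot> \<alpha> = w \<cdot> \<beta>"
proof -
  obtain \<alpha> \<beta> where ab: "x \<cdot> \<alpha> = w \<cdot> \<beta>"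
    and min: "\<And>d e. x \<cdot> d = w \<cdot> e \<Longrightarrow> \<exists>\<gamma>. d = \<alpha> \<cdot> \<gamma> \<and> e = \<beta> \<cdot> \<gamma>"
    using smul_lcm[OF assms(3)] by metis
  obtain c c' t' where t': "R p (x \<cdot> c) t'" "x \<cdot> c = w \<cdot> c'"
    using closed assms by blast
  then obtain z where "c = \<alpha> \<cdot> z"
    using min by blast
  then obtain t where t: "R p (x \<cdot> \<alpha>) t"
    using t'(1) decomp by (metis smul_assoc)
  have "R q \<alpha> t"
    using decomp[OF t] target_unique assms(1) cong_source by blast
  moreover have "R r \<beta> t"
    using decomp[of p w \<beta> t] t ab target_unique assms(2) cong_source by metis
  ultimately show ?thesis
    using that ab min[OF assms(3)] by blast
qed

lemma E_I: "R f x q \<Longrightarrow> R g x' q \<Longrightarrow> f k \<cdot> y = x \<cdot> d \<Longrightarrow> g k = x' \<cdot> d \<Longrightarrow> E f y g"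
  unfolding extension_def by blast

text \<open>The last entry absorbs any factor. For the reversed layer this becomes the totality
  assumed in \<open>E_closed\<close>.\<close>

lemma E_total: "E f x (f(k := f k \<cdot> x))"
  by (rule E_I[OF refl upd(1), of _ _ "f k \<cdot> x"]) simp_all

text \<open>Two instances of \<open>E\<close> with a common point give two arrows of
  \<open>R\<close> out of that point. Merging them by \<open>join\<close> settles composition,
  freeness and both uniqueness axioms.\<close>

lemma E_layer: "layer s E"
proof unfold_locales
  show "E f 1 f" for f
    unfolding extension_def using refl by force
  show "E g 1 f" if "E f 1 g" for f g
    using that unfolding extension_def by (metis smul_one(2))
  show "E f (y \<cdot> z) h" if fg: "E f y g" and gh: "E g z h" for f y g z h
  proof -
    obtain q x x' d where 1: "R f x q" "R g x' q" "f k \<cdot> y = x \<cdot> d" "g k = x' \<cdot> d"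
      using fg unfolding extension_def by blast
    obtain r w w' e where 2: "R g w r" "R h w' r" "g k \<cdot> z = w \<cdot> e" "h k = w' \<cdot> e"
      using gh unfolding extension_def by blast
    have "x' \<cdot> (d \<cdot> z) = w \<cdot> e"
      using 1 2 by (simp add: smul_assoc)
    then obtain \<alpha> \<beta> \<gamma> t where 3: "R q \<alpha> t" "R r \<beta> t" "d \<cdot> z = \<alpha> \<cdot> \<gamma>" "e = \<beta> \<cdot> \<gamma>"
      using join 1(2) 2(1) by metis
    have "f k \<cdot> (y \<cdot> z) = (x \<cdot> \<alpha>) \<cdot> \<gamma>"
      using 1(3) 3(3) by (metis smul_assoc)
    moreover have "h k = (w' \<cdot> \<beta>) \<cdot> \<gamma>"
      using 2(4) 3(4) by (simp add: smul_assoc)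
    ultimately show ?thesis
      unfolding extension_def using comp 1(1) 2(2) 3(1,2) by blast
  qed
  show "\<exists>g. E f x g \<and> E g y h" if "E f (x \<cdot> y) h" for f x y h
  proof (intro exI conjI)
    show "E f x (f(k := f k \<cdot> x))"
      by (rule E_total)
    show "E (f(k := f k \<cdot> x)) y h"
      using that unfolding extension_def by (auto simp: smul_assoc) (metis cong_source upd(2))
  qed
  show "y = z" if fg: "E f y g" and fg': "E f z g" for f y g z
  proof -
    obtain q x x' d where 1: "R f x q" "R g x' q" "f k \<cdot> y = x \<cdot> d" "g k = x' \<cdot> d"
      using fg unfolding extension_def by blast
    obtain r w w' e where 2: "R f w r" "R g w' r" "f k \<cdot> z = w \<cdot> e" "g k = w' \<cdot> e"
      using fg' unfolding extension_def by blast
    obtain \<alpha> \<beta> \<gamma> t where 3: "R q \<alpha> t" "R r \<beta> t" "d = \<alpha> \<cdot> \<gamma>" "e = \<beta> \<cdot> \<gamma>"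
      using join[of g x' q w' r d e] 1 2 by metis
    have "x \<cdot> \<alpha> = w \<cdot> \<beta>"
      using free comp 1(1) 2(1) 3(1,2) by blast
    then have "f k \<cdot> y = f k \<cdot> z"
      using 1(3) 2(3) 3(3,4) by (metis smul_assoc)
    then show ?thesis
      by simp
  qed
  show "E g 1 g'" if fg: "E f y g" and fg': "E f y g'" for f y g g'
  proof -
    obtain q x x' d where 1: "R f x q" "R g x' q" "f k \<cdot> y = x \<cdot> d" "g k = x' \<cdot> d"
      using fg unfolding extension_def by blast
    obtain r w w' e where 2: "R f w r" "R g' w' r" "f k \<cdot> y = w \<cdot> e" "g' k = w' \<cdot> e"
      using fg' unfolding extension_def by blast
    obtain \<alpha> \<beta> \<gamma> t where 3: "R q \<alpha> t" "R r \<beta> t" "d = \<alpha> \<cdot> \<gamma>" "e = \<beta> \<cdot> \<gamma>"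
      using join[of f x q w r d e] 1 2 by metis
    have "g k \<cdot> 1 = (x' \<cdot> \<alpha>) \<cdot> \<gamma>" "g' k = (w' \<cdot> \<beta>) \<cdot> \<gamma>"
      using 1(4) 2(4) 3(3,4) by (simp_all add: smul_assoc)
    then show ?thesis
      unfolding extension_def using comp 1(2) 2(2) 3(1,2) by blast
  qed
  show "E f 1 f'" if fg: "E f y g" and fg': "E f' y g" for f f' y g
  proof -
    obtain q x x' d where 1: "R f x q" "R g x' q" "f k \<cdot> y = x \<cdot> d" "g k = x' \<cdot> d"
      using fg unfolding extension_def by blast
    obtain r w w' e where 2: "R f' w r" "R g w' r" "f' k \<cdot> y = w \<cdot> e" "g k = w' \<cdot> e"
      using fg' unfolding extension_def by blast
    obtain \<alpha> \<beta> \<gamma> t where 3: "R q \<alpha> t" "R r \<beta> t" "d = \<alpha> \<cdot> \<gamma>" "e = \<beta> \<cdot> \<gamma>"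
      using join[of g x' q w' r d e] 1 2 by metis
    have 4: "f k \<cdot> y = (x \<cdot> \<alpha>) \<cdot> \<gamma>" "f' k \<cdot> y = (w \<cdot> \<beta>) \<cdot> \<gamma>"
      using 1(3) 2(3) 3(3,4) by (simp_all add: smul_assoc)
    \<comment> \<open>Both equations in \<open>4\<close> have the shape
      \<open>c \<cdot> y = z \<cdot> \<gamma>\<close>, so they factor through the lcm of
      \<open>y\<close> and \<open>\<gamma>\<close> on the other side. Moving \<open>\<delta>\<close>
      and \<open>\<delta>'\<close> into \<open>R\<close> then leaves the same last factor
      \<open>a\<close>.\<close>
    obtain a b where "\<And>c z. c \<cdot> y = z \<cdot> \<gamma> \<Longrightarrow> \<exists>\<delta>. c = \<delta> \<cdot> a \<and> z = \<delta> \<cdot> b"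
      using smul_lcm[of "\<not> s" y "f k" \<gamma> "x \<cdot> \<alpha>"] 4(1) unfolding smul_flip by metis
    then obtain \<delta> \<delta>' where 5: "f k = \<delta> \<cdot> a" "x \<cdot> \<alpha> = \<delta> \<cdot> b" "f' k = \<delta>' \<cdot> a" "w \<cdot> \<beta> = \<delta>' \<cdot> b"
      using 4 by blast
    have "R f (\<delta> \<cdot> b) t" "R f' (\<delta>' \<cdot> b) t"
      using comp 1(1) 2(1) 3(1,2) 5(2,4) by metis+
    then obtain m m' where m: "R f \<delta> m" "R m b t" "R f' \<delta>' m'" "R m' b t"
      using decomp by blast
    then have "R f' \<delta>' m"
      using source_unique cong_target by blast
    then show ?thesis
      unfolding extension_def using m(1) 5(1,3) by auto
  qed
qed

lemma E_local: "(\<And>i. i < Suc k \<Longrightarrow> f i = f' i) \<Longrightarrow> E f 1 f'"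
  by (rule E_I[OF refl sym[OF local], of _ _ _ "f k"]) simp_all

text \<open>This is the only place where the \<open>3\<close>-Ore condition enters.\<close>

lemma E_closed:
  assumes ore: "three_Ore TYPE('a)" and total: "\<And>q x. \<exists>p. R p x q"
    and fh: "E f y h" and gh: "E g z h" and yz: "a \<cdot> y = b \<cdot> z"
  shows "\<exists>c d e. E e (c \<cdot> y) h \<and> c \<cdot> y = d \<cdot> z"
proof -
  obtain q x x' d where 1: "R f x q" "R h x' q" "f k \<cdot> y = x \<cdot> d" "h k = x' \<cdot> d"
    using fh unfolding extension_def by blast
  obtain r w w' e where 2: "R g w r" "R h w' r" "g k \<cdot> z = w \<cdot> e" "h k = w' \<cdot> e"
    using gh unfolding extension_def by blast
  obtain \<alpha> \<beta> \<gamma> t where 3: "R q \<alpha> t" "R r \<beta> t" "d = \<alpha> \<cdot> \<gamma>" "e = \<beta> \<cdot> \<gamma>"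
    using join[of h x' q w' r d e] 1 2 by metis
  have "f k \<cdot> y = (x \<cdot> \<alpha>) \<cdot> \<gamma>" "g k \<cdot> z = (w \<cdot> \<beta>) \<cdot> \<gamma>"
    using 1(3) 2(3) 3(3,4) by (simp_all add: smul_assoc)
  \<comment> \<open>The elements \<open>y\<close>, \<open>z\<close>, \<open>\<gamma>\<close>
    pairwise have common multiples: \<open>yz\<close> for the first two, the preceding equations for
    the pairs with \<open>\<gamma>\<close>.\<close>
  with ore yz obtain c c' c'' where 4: "c \<cdot> y = c' \<cdot> z" "c \<cdot> y = c'' \<cdot> \<gamma>"
    using smul_three_Ore by blast
  obtain t' where t': "R t' c'' t"
    using total by blast
  \<comment> \<open>From \<open>t'\<close> with last factor 1, multiplication by
    \<open>c \<cdot> y = c'' \<cdot> \<gamma>\<close> leads through \<open>t\<close> to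
    \<open>h\<close>.\<close>
  have "E (t'(k := 1)) (c \<cdot> y) h"
    unfolding extension_def
  proof (intro exI conjI)
    show "R (t'(k := 1)) c'' t"
      using t' cong_source upd(2) by blast
    show "R h (x' \<cdot> \<alpha>) t"
      using comp 1(2) 3(1) by blast
    show "(t'(k := 1)) k \<cdot> (c \<cdot> y) = c'' \<cdot> \<gamma>"
      using 4(2) by simp
    show "h k = (x' \<cdot> \<alpha>) \<cdot> \<gamma>"
      using 1(4) 3(3) by (simp add: smul_assoc)
  qed
  then show ?thesis
    using 4(1) by blast
qed

text \<open>Padding with 1 embeds a layer in its extension: 1 has only the trivial factorization, so
  nothing can be moved out of the last entry of \<open>g\<close>.\<close>

lemma E_trivial:
  assumes "f k = 1" "g k = 1"
  shows "E f y g \<longleftrightarrow> R f y g"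
proof
  assume "E f y g"
  then obtain q x d where "R f x q" "R g 1 q" "y = x \<cdot> d" "d = 1"
    unfolding extension_def using assms by (metis smul_eq_one_iff smul_one(1))
  then show "R f y g"
    using sym cong_target by (metis smul_one(2))
next
  assume "R f y g"
  then show "E f y g"
    unfolding extension_def using assms refl by (metis smul_one)
qed

end


section \<open>The universal covering of the layers\<close>

text \<open>
  \<open>layer_rel k f y g\<close> relates the zigzags with labels \<open>f 0, \<dots>, f (k - 1)\<close> and \<open>g 0, \<dots>, g (k - 1)\<close> from the
  base point: the second ends at the end of the first, multiplied by \<open>y\<close> if \<open>k\<close> is odd, and by the
  inverse of \<open>y\<close> if \<open>k\<close> is even.
\<close>

primrec layer_rel :: "nat \<Rightarrow> (nat \<Rightarrow> 'a::gcd_monoid) \<Rightarrow> 'a \<Rightarrow> (nat \<Rightarrow> 'a) \<Rightarrow> bool" where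
  "layer_rel 0 = (\<lambda>f y g. y = 1)"
| "layer_rel (Suc k) = extension (even k) k (\<lambda>f y g. layer_rel k g y f)"

text \<open>Layer 0 is a single point on which only 1 acts, hence the guard \<open>0 < k\<close> for
  totality.\<close>

lemma layer_rel_invariant:
  assumes ore: "three_Ore TYPE('a::gcd_monoid)"
  shows "closed_layer (even k) (\<lambda>f y g. layer_rel k g (y::'a) f) k \<and> (0 < k \<longrightarrow> (\<forall>f (x::'a). \<exists>g. layer_rel k f x g))"
proof (induction k)
  case 0
  show ?case
    by (simp add: closed_layer_def closed_layer_axioms_def layer_def)
next
  case IH: (Suc k)
  interpret closed_layer "even k" "\<lambda>f y g. layer_rel k g (y::'a) f" k
    using IH by blast
  have layer: "layer (even k) (layer_rel (Suc k) :: _ \<Rightarrow> 'a \<Rightarrow> _)"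
    using E_layer by simp
  have closed: "\<exists>c d e. layer_rel (Suc k) e (smul (even k) c y) h \<and> smul (even k) c y = smul (even k) d z"
    if "layer_rel (Suc k) f y h" "layer_rel (Suc k) g z h" "smul (even k) a y = smul (even k) b z"
    for f g h and a b y z :: 'a
  proof (cases k)
    case 0
    then show ?thesis
      using that(1,2)
      by (intro exI[of _ "f 0"] exI[of _ "g 0"] exI[of _ "\<lambda>_. 1"]) (auto simp: extension_def)
  next
    case (Suc j)
    then have "0 < k"
      by simp
    then have "\<exists>p. layer_rel k q x p" for q and x :: 'a
      using IH by blast
    from E_closed[OF ore this] show ?thesis
      using that by simp
  qed
  have "closed_layer (even (Suc k)) (\<lambda>f y g. layer_rel (Suc k) g (y::'a) f) (Suc k)"
  proof (intro closed_layer.intro closed_layer_axioms.intro)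
    show "layer (even (Suc k)) (\<lambda>f y g. layer_rel (Suc k) g (y::'a) f)"
      using layer.dual[OF layer] by simp
    show "layer_rel (Suc k) f' 1 f" if "\<And>i. i < Suc k \<Longrightarrow> f i = f' i" for f f' :: "nat \<Rightarrow> 'a"
      using that E_local[of f' f] by simp
    show "\<exists>c d r. layer_rel (Suc k) r (smul (even (Suc k)) x c) p
        \<and> smul (even (Suc k)) x c = smul (even (Suc k)) y d"
      if "layer_rel (Suc k) q x p" "layer_rel (Suc k) q' y p"
        "smul (even (Suc k)) x a = smul (even (Suc k)) y b" for p q q' and x y a b :: 'a
      using that closed[of q x p q' y a b] unfolding even_Suc smul_flip by blast
  qed
  then show ?case
    using E_total by auto
qed

section \<open>The union of the layers and the action of the enveloping group\<close>

definition supp_below :: "nat \<Rightarrow> (nat \<Rightarrow> 'a::one) \<Rightarrow> bool" where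
  "supp_below k f \<longleftrightarrow> (\<forall>i\<ge>k. f i = 1)"

definition cut :: "nat \<Rightarrow> (nat \<Rightarrow> 'a::one) \<Rightarrow> nat \<Rightarrow> 'a" where
  "cut k f = (\<lambda>i. if i < k then f i else 1)"

lemma supp_below_cut [simp]: "supp_below k (cut k f)"
  by (simp add: supp_below_def cut_def)

lemma supp_below_mono: "supp_below k f \<Longrightarrow> k \<le> l \<Longrightarrow> supp_below l f"
  by (simp add: supp_below_def)

text \<open>Orients the layers of both parities alike: \<open>g\<close> is \<open>f\<close>
  multiplied by \<open>y\<close> on the right.\<close>

definition pos_edge :: "nat \<Rightarrow> (nat \<Rightarrow> 'a::gcd_monoid) \<Rightarrow> 'a \<Rightarrow> (nat \<Rightarrow> 'a) \<Rightarrow> bool" where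
  "pos_edge k f y g \<longleftrightarrow> (if odd k then layer_rel k f y g else layer_rel k g y f)"

definition edge :: "(nat \<Rightarrow> 'a::gcd_monoid) \<Rightarrow> 'a \<Rightarrow> (nat \<Rightarrow> 'a) \<Rightarrow> bool" where
  "edge f y g \<longleftrightarrow> (\<exists>k. supp_below k f \<and> supp_below k g \<and> pos_edge k f y g)"

primrec path :: "('a::gcd_monoid \<times> bool) list \<Rightarrow> (nat \<Rightarrow> 'a) \<Rightarrow> (nat \<Rightarrow> 'a) \<Rightarrow> bool" where
  "path [] f g = edge f 1 g"
| "path (p # w) f g =
     (\<exists>h. (if snd p then edge f (fst p) h else edge h (fst p) f) \<and> path w h g)"

context
  assumes ore: "three_Ore TYPE('a::gcd_monoid)"
begin

lemma closed_layer_rel: "closed_layer (even k) (\<lambda>f y g. layer_rel k g (y::'a) f) k"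
  using layer_rel_invariant[OF ore] by blast

lemma layer_layer_rel: "layer (odd k) (layer_rel k :: _ \<Rightarrow> 'a \<Rightarrow> _)"
  using layer.dual[OF closed_layer.axioms(1)[OF closed_layer_rel]] by simp

lemma layer_pos_edge: "layer True (pos_edge k :: _ \<Rightarrow> 'a \<Rightarrow> _)"
proof (cases "odd k")
  case True
  then have "pos_edge k = (layer_rel k :: _ \<Rightarrow> 'a \<Rightarrow> _)"
    by (simp add: pos_edge_def fun_eq_iff)
  then show ?thesis
    using layer_layer_rel[of k] True by simp
next
  case False
  then have "pos_edge k = (\<lambda>f (y::'a) g. layer_rel k g y f)"
    by (simp add: pos_edge_def fun_eq_iff)
  then show ?thesis
    using closed_layer.axioms(1)[OF closed_layer_rel[of k]] False by simp
qed

lemma pos_edge_local: "(\<And>i. i < k \<Longrightarrow> f i = f' i) \<Longrightarrow> pos_edge k f (1::'a) f'"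
  unfolding pos_edge_def using closed_layer.local[OF closed_layer_rel, of k] by (metis (no_types))

lemma pos_edge_cut: "pos_edge k f (1::'a) (cut k f)"
  by (rule pos_edge_local) (simp add: cut_def)

lemma pos_edge_Suc:
  assumes "f k = 1" "g k = (1::'a)"
  shows "pos_edge (Suc k) f y g \<longleftrightarrow> pos_edge k f y g"
proof -
  have "layer_rel (Suc k) f y g \<longleftrightarrow> layer_rel k g y f" "layer_rel (Suc k) g y f \<longleftrightarrow> layer_rel k f y g"
    unfolding layer_rel.simps by (rule closed_layer.E_trivial[OF closed_layer_rel]; fact)+
  then show ?thesis
    unfolding pos_edge_def by (cases "even k") (simp_all del: layer_rel.simps)
qed

text \<open>Padding preserves and reflects edges by \<open>pos_edge_Suc\<close>, so every bound on
  the supports gives the same answer.\<close>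

lemma edge_iff:
  assumes "supp_below k f" "supp_below k (g :: _ \<Rightarrow> 'a)"
  shows "edge f y g \<longleftrightarrow> pos_edge k f y g"
proof -
  have mono: "pos_edge (k + j) f y g \<longleftrightarrow> pos_edge k f y g"
    if "supp_below k f" "supp_below k g" for j k
    using that by (induction j) (simp_all add: pos_edge_Suc supp_below_def)
  have "pos_edge l f y g \<longleftrightarrow> pos_edge k f y g" if "supp_below l f" "supp_below l g" for l
    using mono[OF that, of k] mono[OF assms, of l] by (simp add: add.commute)
  then show ?thesis
    unfolding edge_def using assms by blast
qed

lemma edge_refl: "supp_below k f \<Longrightarrow> edge f (1::'a) f"
  unfolding edge_def using layer.refl[OF layer_pos_edge] by blast

lemma edgeE:
  assumes "edge f y (g :: _ \<Rightarrow> 'a)"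
  obtains k where "supp_below k f" "supp_below k g" "\<And>l. k \<le> l \<Longrightarrow> pos_edge l f y g"
proof -
  obtain k where k: "supp_below k f" "supp_below k g"
    using assms unfolding edge_def by blast
  then have "pos_edge l f y g" if "k \<le> l" for l
    using assms that edge_iff supp_below_mono by metis
  with k show ?thesis
    using that by blast
qed

lemma edge_sym: "edge f 1 g \<Longrightarrow> edge g (1::'a) f"
  unfolding edge_def using layer.sym[OF layer_pos_edge] by blast

lemma edge_comp:
  assumes "edge f x g" "edge g (y::'a) h"
  shows "edge f (x * y) h"
proof -
  obtain k l where "supp_below k f" "\<And>l. k \<le> l \<Longrightarrow> pos_edge l f x g"
    and "supp_below l h" "\<And>k. l \<le> k \<Longrightarrow> pos_edge k g y h"
    using assms edgeE by metis
  then show ?thesis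
    unfolding edge_def using layer.comp[OF layer_pos_edge, of "max k l" f x g y h]
    by (intro exI[of _ "max k l"]) (auto simp: smul_def intro: supp_below_mono)
qed

lemma edge_decomp:
  assumes "edge f (x * y) (h :: _ \<Rightarrow> 'a)"
  obtains g where "edge f x g" "edge g y h"
proof -
  obtain k where k: "supp_below k f" "supp_below k h" "pos_edge k f (smul True x y) h"
    using assms unfolding edge_def smul_def by auto
  obtain g where g: "pos_edge k f x g" "pos_edge k g y h"
    using layer.decomp[OF layer_pos_edge, of k f x y h] k(3) by blast
  then have "pos_edge k f x (cut k g)" "pos_edge k (cut k g) y h"
    using layer.cong_target[OF layer_pos_edge] layer.cong_source[OF layer_pos_edge] pos_edge_cut
    by metis+
  then show ?thesis
    using that k unfolding edge_def by (metis supp_below_cut)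
qed

lemma edge_target_unique:
  assumes "edge f x g" "edge f (x::'a) h"
  shows "edge g 1 h"
proof -
  obtain k l where "supp_below k g" "\<And>l. k \<le> l \<Longrightarrow> pos_edge l f x g"
    and "supp_below l h" "\<And>k. l \<le> k \<Longrightarrow> pos_edge k f x h"
    using assms edgeE by metis
  then show ?thesis
    unfolding edge_def using layer.target_unique[OF layer_pos_edge, of "max k l" f x g h]
    by (intro exI[of _ "max k l"]) (auto intro: supp_below_mono)
qed

lemma edge_source_unique:
  assumes "edge g x f" "edge h (x::'a) f"
  shows "edge g 1 h"
proof -
  obtain k l where "supp_below k g" "\<And>l. k \<le> l \<Longrightarrow> pos_edge l g x f"
    and "supp_below l h" "\<And>k. l \<le> k \<Longrightarrow> pos_edge k h x f"
    using assms edgeE by metis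
  then show ?thesis
    unfolding edge_def using layer.source_unique[OF layer_pos_edge, of "max k l" g x f h]
    by (intro exI[of _ "max k l"]) (auto intro: supp_below_mono)
qed

lemma layer_rel_total: "0 < k \<Longrightarrow> \<exists>g. layer_rel k f (x::'a) g"
  using layer_rel_invariant[OF ore] by blast

text \<open>Odd layers are total forwards, positive even layers backwards, and each zigzag lies in
  layers of both kinds after padding.\<close>

lemma edge_total:
  assumes "supp_below k f"
  shows "\<exists>g. edge f (x::'a) g" "\<exists>g. edge g x f"
proof -
  have "\<exists>g. pos_edge l f x g \<and> supp_below l g" if l: "odd l" for l
  proof -
    obtain g where "pos_edge l f x g"
      using l layer_rel_total[of l f x] odd_pos[of l] pos_edge_def by metis
    then have "pos_edge l f x (cut l g)"
      using layer.cong_target[OF layer_pos_edge] pos_edge_cut by metis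
    then show ?thesis
      by auto
  qed
  then show "\<exists>g. edge f x g"
    unfolding edge_def using assms supp_below_mono[of k f "2 * k + 1"]
    by (metis even_plus_one_iff even_mult_iff even_numeral le_add1 mult_2 add.assoc)
  have "\<exists>g. pos_edge l g x f \<and> supp_below l g" if l: "even l" "0 < l" for l
  proof -
    obtain g where "pos_edge l g x f"
      using l layer_rel_total[of l f x] pos_edge_def by metis
    then have "pos_edge l (cut l g) x f"
      using layer.cong_source[OF layer_pos_edge] pos_edge_cut by metis
    then show ?thesis
      by auto
  qed
  then show "\<exists>g. edge g x f"
    unfolding edge_def using assms supp_below_mono[of k f "2 * k + 2"]
    by (metis even_add even_mult_iff even_numeral le_add1 mult_2 add.assoc add_gr_0 zero_less_numeral)
qed

lemma edge_cong:
  assumes "edge f (1::'a) f'"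
  shows "edge f x g \<longleftrightarrow> edge f' x g" "edge g x f \<longleftrightarrow> edge g x f'"
  using edge_comp[OF assms, of x g] edge_comp[OF edge_sym[OF assms], of x g]
    edge_comp[OF _ assms, of g x] edge_comp[OF _ edge_sym[OF assms], of g x]
  by (simp_all only: mult_1 mult_1_right) blast+

lemma path_cong_source:
  assumes "edge f (1::'a) f'"
  shows "path w f g \<longleftrightarrow> path w f' g"
  using edge_cong[OF assms] by (cases w) simp_all

lemma path_finite: "path w f g \<Longrightarrow> \<exists>k. supp_below k f \<and> supp_below k (g :: _ \<Rightarrow> 'a)"
proof (induction w arbitrary: f)
  case Nil
  then show ?case
    by (auto simp: edge_def)
next
  case (Cons p w)
  then obtain h k l where "supp_below k f" "supp_below l g"
    by (auto simp: edge_def split: if_splits) blast+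
  then show ?case
    by (intro exI[of _ "max k l"]) (auto intro: supp_below_mono)
qed

lemma path_append: "path (v @ w) f (g :: _ \<Rightarrow> 'a) \<longleftrightarrow> (\<exists>h. path v f h \<and> path w h g)"
proof (induction v arbitrary: f)
  case Nil
  show ?case
    using path_cong_source path_finite edge_refl by fastforce
next
  case (Cons p v)
  then show ?case
    by auto
qed

lemma path_singleton:
  "path [(a, True)] f g \<longleftrightarrow> edge f (a::'a) g" "path [(a, False)] f g \<longleftrightarrow> edge g (a::'a) f"
proof -
  have "edge h 1 g \<Longrightarrow> edge f a h \<longleftrightarrow> edge f a g" "edge h 1 g \<Longrightarrow> edge h a f \<longleftrightarrow> edge g a f" for h
    using edge_cong by blast+
  moreover have "edge g 1 g" if "edge f a g \<or> edge g a f"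
    using that edge_refl unfolding edge_def by blast
  ultimately show "path [(a, True)] f g \<longleftrightarrow> edge f a g" "path [(a, False)] f g \<longleftrightarrow> edge g a f"
    unfolding path.simps fst_conv snd_conv if_True if_False by blast+
qed

text \<open>Products are handled by composition and decomposition, inverses by totality and
  uniqueness; hence the enveloping group acts on the union.\<close>

lemma path_env_eq: "env_eq v w \<Longrightarrow> path v f g \<longleftrightarrow> path w f (g :: _ \<Rightarrow> 'a)"
proof (induction arbitrary: f g rule: env_eq.induct)
  case (env_append v v' w w')
  then show ?case
    by (simp add: path_append)
next
  case env_one
  show ?case
    by (simp add: path_singleton del: path.simps(2))
next
  case (env_mult a b)
  have "path [(a, True), (b, True)] f g \<longleftrightarrow> (\<exists>h. edge f a h \<and> edge h b g)"
    using path_append[of "[(a, True)]" "[(b, True)]"] by (simp add: path_singleton del: path.simps(2))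
  also have "\<dots> \<longleftrightarrow> edge f (a * b) g"
    using edge_comp edge_decomp by metis
  finally show ?case
    by (simp add: path_singleton del: path.simps(2))
next
  case (env_right_inverse a)
  have "path [(a, True), (a, False)] f g \<longleftrightarrow> (\<exists>h. edge f a h \<and> edge g a h)"
    using path_append[of "[(a, True)]" "[(a, False)]"]
    by (simp add: path_singleton del: path.simps(2))
  also have "\<dots> \<longleftrightarrow> edge f 1 g"
    using edge_source_unique edge_total edge_cong by (metis edge_def)
  finally show ?case
    by simp
next
  case (env_left_inverse a)
  have "path [(a, False), (a, True)] f g \<longleftrightarrow> (\<exists>h. edge h a f \<and> edge h a g)"
    using path_append[of "[(a, False)]" "[(a, True)]"]
    by (simp add: path_singleton del: path.simps(2))
  also have "\<dots> \<longleftrightarrow> edge f 1 g"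
    using edge_target_unique edge_total edge_cong by (metis edge_def)
  finally show ?case
    by simp
qed auto


lemma path_unique: "path w f g \<Longrightarrow> path w f h \<Longrightarrow> edge g (1::'a) h"
proof (induction w arbitrary: f)
  case Nil
  then show ?case
    using edge_cong edge_sym by (metis path.simps(1))
next
  case (Cons p w)
  then obtain g' h' where "path w g' g" "path w h' h"
    and "if snd p then edge f (fst p) g' \<and> edge f (fst p) h'
      else edge g' (fst p) f \<and> edge h' (fst p) f"
    by auto
  then show ?case
    using Cons.IH path_cong_source edge_target_unique edge_source_unique by (metis (full_types))
qed

end

section \<open>The enveloping group\<close>

interpretation U: Groups.group "(*)" 1 "inverse :: 'a::monoid_mult enveloping_group \<Rightarrow> _"
  by (rule group_enveloping_group)

definition signed :: "bool \<Rightarrow> 'a::monoid_mult \<Rightarrow> 'a enveloping_group" where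
  "signed s a = (if s then \<iota> a else inverse (\<iota> a))"

lemma signed_one [simp]: "signed s 1 = 1"
  by (simp add: signed_def \<iota>_one)

lemma signed_smul: "signed s (smul s a b) = signed s a * signed s b"
  by (simp add: signed_def smul_def \<iota>_mult U.inverse_distrib_swap)

lemma signed_flip [simp]: "signed s a * signed (\<not> s) a = 1" "signed (\<not> s) a * signed s a = 1"
  by (simp_all add: signed_def)

lemma signed_flip_eq: "g = h * signed (\<not> s) a \<longleftrightarrow> h = g * signed s a"
  by (auto simp: mult.assoc)

lemma signed_abs: "abs_enveloping_group [(a, s)] = signed s a"
  by (simp add: signed_def inverse_\<iota>_abs) (simp add: \<iota>.abs_eq)

primrec product :: "nat \<Rightarrow> (nat \<Rightarrow> 'a::monoid_mult) \<Rightarrow> 'a enveloping_group" where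
  "product 0 f = 1"
| "product (Suc k) f = product k f * signed (even k) (f k)"

lemma product_cong: "(\<And>i. i < k \<Longrightarrow> f i = g i) \<Longrightarrow> product k f = product k g"
  by (induction k) auto

lemma product_upd [simp]: "product k (f(k := x)) = product k f"
  by (rule product_cong) simp

lemma unital_product: "unital a \<longleftrightarrow> product (length a) ((!) a) = 1"
proof -
  have "prod_list (map (\<lambda>j. if even j then \<iota> (a ! j) else inverse (\<iota> (a ! j))) [0..<k]) =
      product k ((!) a)" for k
    by (induction k) (simp_all add: signed_def)
  then show ?thesis
    by (simp add: unital_def)
qed

text \<open>Soundness: moving factors between consecutive entries does not change the endpoint in
  the group.\<close>

lemma layer_rel_product: "layer_rel k f y g \<Longrightarrow> product k g = product k f * signed (odd k) y"
proof (induction k arbitrary: f y g)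
  case 0
  then show ?case
    by simp
next
  case (Suc k)
  then obtain q x x' d where q: "layer_rel k q x f" "layer_rel k q x' g"
    and d: "smul (even k) (f k) y = smul (even k) x d" "g k = smul (even k) x' d"
    by (auto simp: extension_def)
  have "product k q = product k f * signed (even k) x" "product k q = product k g * signed (even k) x'"
    using Suc.IH[OF q(1)] Suc.IH[OF q(2)] by (simp_all add: signed_flip_eq)
  then show ?case
    using arg_cong[OF d(1), of "signed (even k)"] d(2) by (simp add: signed_smul flip: mult.assoc) (metis mult.assoc)
qed

definition word :: "nat \<Rightarrow> (nat \<Rightarrow> 'a) \<Rightarrow> ('a \<times> bool) list" where
  "word k f = map (\<lambda>i. (f i, even i)) [0..<k]"

lemma word_Suc: "word (Suc k) f = word k f @ [(f k, even k)]"
  by (simp add: word_def)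

lemma abs_word: "abs_enveloping_group (word k f) = product k f"
proof (induction k)
  case 0
  show ?case
    by (simp add: word_def one_enveloping_group.abs_eq)
next
  case (Suc k)
  then show ?case
    by (simp add: word_Suc flip: signed_abs times_enveloping_group.abs_eq)
qed

section \<open>The divisibility order on the enveloping group and its zigzags\<close>

definition cmp :: "bool \<Rightarrow> 'a::monoid_mult enveloping_group \<Rightarrow> 'a enveloping_group \<Rightarrow> bool" where
  "cmp s g h \<longleftrightarrow> (\<exists>x. h = g * signed s x)"

lemma cmp_flip [simp]: "cmp (\<not> s) g h \<longleftrightarrow> cmp s h g"
  by (simp add: cmp_def signed_flip_eq)

lemma cmp_False [simp]: "cmp False g h \<longleftrightarrow> cmp True h g"
  using cmp_flip[of True] by simp

lemma cmp_True_iff: "cmp True g h \<longleftrightarrow> (\<exists>x. h = g * \<iota> x)"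
  by (simp add: cmp_def signed_def)

lemma cmp_mult: "cmp s g (g * signed s x)"
  by (auto simp: cmp_def)

lemma cmp_trans: "cmp s g h \<Longrightarrow> cmp s h k \<Longrightarrow> cmp s g k"
  unfolding cmp_def by (auto simp: mult.assoc simp flip: signed_smul)

definition zigzag :: "nat \<Rightarrow> (nat \<Rightarrow> 'a::monoid_mult enveloping_group) \<Rightarrow> bool" where
  "zigzag n u \<longleftrightarrow> u 0 = 1 \<and> (\<forall>i<n. cmp (even i) (u i) (u (Suc i)))"

lemma zigzagD: "zigzag n u \<Longrightarrow> u 0 = 1" "zigzag n u \<Longrightarrow> i < n \<Longrightarrow> cmp (even i) (u i) (u (Suc i))"
  by (simp_all add: zigzag_def)

lemma zigzag_mono: "zigzag n u \<Longrightarrow> m \<le> n \<Longrightarrow> zigzag m u"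
  by (simp add: zigzag_def)

lemma zigzag_range_product: "zigzag n u \<Longrightarrow> u n \<in> range (product n)"
proof (induction n)
  case 0
  then show ?case
    by (simp add: zigzag_def)
next
  case (Suc n)
  then obtain f x where "u n = product n f" "u (Suc n) = u n * signed (even n) x"
    by (auto simp: zigzag_def cmp_def less_Suc_eq)
  then have "u (Suc n) = product (Suc n) (f(n := x))"
    by simp
  then show ?case
    by blast
qed

context
  assumes ore: "three_Ore TYPE('a::gcd_monoid)"
begin

text \<open>Started at the trivial zigzag, the word of \<open>f\<close> writes its letters one after
  another into the entries.\<close>

lemma path_word: "path (word k f) (\<lambda>_. 1) (cut k f :: _ \<Rightarrow> 'a)"
proof (induction k)
  case 0
  have "edge (\<lambda>_. 1) (1::'a) (\<lambda>_. 1)"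
    by (rule edge_refl[OF ore, of 0]) (simp add: supp_below_def)
  then show ?case
    by (simp add: word_def cut_def)
next
  case (Suc k)
  have upd: "cut (Suc k) f = (cut k f)(k := smul (even k) (cut k f k) (f k))"
    by (auto simp: cut_def fun_eq_iff)
  have "layer_rel (Suc k) (cut k f) (f k) (cut (Suc k) f)"
    unfolding upd layer_rel.simps by (rule closed_layer.E_total[OF closed_layer_rel[OF ore]])
  then have "path [(f k, even k)] (cut k f) (cut (Suc k) f)"
    using supp_below_mono[OF supp_below_cut, of k "Suc k" f]
    by (cases "even k")
      (simp_all add: path_singleton[OF ore] edge_iff[OF ore, of "Suc k"] pos_edge_def
        del: path.simps layer_rel.simps)
  then show ?case
    using Suc path_append[OF ore] unfolding word_Suc by blast
qed

text \<open>Completeness: words with equal products act alike on the trivial zigzag, and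
  \<open>path_word\<close> identifies the results with \<open>f\<close> and \<open>g\<close>, cut at
  \<open>k\<close>.\<close>

lemma layer_rel_of_product_eq:
  fixes f g :: "nat \<Rightarrow> 'a"
  assumes "product k f = product k g"
  shows "layer_rel k f 1 g"
proof -
  have "env_eq (word k f) (word k g)"
    using assms by (simp add: enveloping_group.abs_eq_iff flip: abs_word)
  then have "edge (cut k f) 1 (cut k g)"
    using path_unique[OF ore] path_env_eq[OF ore] path_word by metis
  then have "pos_edge k (cut k f) 1 (cut k g)"
    using edge_iff[OF ore] supp_below_cut by metis
  then have "pos_edge k f 1 g"
    using pos_edge_cut[OF ore] layer.cong_source[OF layer_pos_edge[OF ore]]
      layer.cong_target[OF layer_pos_edge[OF ore]] layer.sym[OF layer_pos_edge[OF ore]] by metis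
  then show ?thesis
    unfolding pos_edge_def using layer.sym[OF layer_layer_rel[OF ore]] by metis
qed

lemma product_eqE:
  fixes f g :: "nat \<Rightarrow> 'a"
  assumes "product (Suc k) f = product (Suc k) g"
  obtains q x x' d where
    "product k q = product k f * signed (even k) x" "f k = smul (even k) x d"
    "product k q = product k g * signed (even k) x'" "g k = smul (even k) x' d"
proof -
  obtain q x x' d where q: "layer_rel k q x f" "layer_rel k q x' g"
    and d: "f k = smul (even k) x d" "g k = smul (even k) x' d"
    using layer_rel_of_product_eq[OF assms] by (auto simp: extension_def)
  have "product k q = product k f * signed (even k) x" "product k q = product k g * signed (even k) x'"
    using layer_rel_product[OF q(1)] layer_rel_product[OF q(2)] by (simp_all add: signed_flip_eq)
  with d that show ?thesis
    by blast
qed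

lemma inj_\<iota>: "\<iota> a = \<iota> b \<longleftrightarrow> a = (b :: 'a)"
proof
  assume "\<iota> a = \<iota> b"
  then have "product (Suc 0) (\<lambda>_. a) = product (Suc 0) (\<lambda>_. b)"
    by (simp add: signed_def)
  then have "layer_rel (Suc 0) (\<lambda>_. a) 1 (\<lambda>_. b)"
    by (rule layer_rel_of_product_eq)
  then show "a = b"
    by (auto simp: extension_def)
qed simp

text \<open>Appending \<open>x\<close> and \<open>y\<close> gives two zigzags of length
  \<open>k + 2\<close> ending at \<open>t\<close>. The point supplied by \<open>product_eqE\<close>
  lies beyond \<open>p\<close> and \<open>q\<close>, and dropping its last entry moves further in
  the same direction.\<close>

lemma range_product_directed:
  fixes t :: "'a enveloping_group"
  assumes "p \<in> range (product (Suc k))" "q \<in> range (product (Suc k))"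
    and "cmp (odd k) p t" "cmp (odd k) q t"
  obtains r where "r \<in> range (product k)" "cmp (odd k) p r" "cmp (odd k) q r"
proof -
  obtain f g x y where pq: "p = product (Suc k) f" "q = product (Suc k) g"
    and t: "t = p * signed (odd k) x" "t = q * signed (odd k) y"
    using assms unfolding cmp_def image_iff by blast
  have "product (Suc (Suc k)) (f(Suc k := x)) = product (Suc (Suc k)) (g(Suc k := y))"
    unfolding product.simps(2)[of "Suc k"] product_upd using t pq by simp
  then obtain h z z' where h: "product (Suc k) h = p * signed (odd k) z"
    "product (Suc k) h = q * signed (odd k) z'"
    by (rule product_eqE) (simp only: product_upd even_Suc flip: pq)
  have "cmp (even k) (product k h) (product (Suc k) h)"
    by (simp add: cmp_mult)
  then have "cmp (odd k) (product (Suc k) h) (product k h)"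
    by simp
  then show ?thesis
    using that h cmp_mult cmp_trans by (metis rangeI)
qed

text \<open>Seen from \<open>s1\<close>, the paths through \<open>t1\<close> and \<open>t2\<close>
  are zigzags of length 2 with the same endpoint \<open>s2\<close>; the meeting point from
  \<open>product_eqE\<close>, translated by \<open>s1\<close>, is the centre.\<close>

lemma interpolation:
  fixes s1 s2 t1 t2 :: "'a enveloping_group"
  assumes "cmp True s1 t1" "cmp True s1 t2" "cmp True s2 t1" "cmp True s2 t2"
  obtains x where "cmp True s1 x" "cmp True s2 x" "cmp True x t1" "cmp True x t2"
proof -
  obtain a b c d where t: "t1 = s1 * \<iota> a" "t1 = s2 * \<iota> b" "t2 = s1 * \<iota> c" "t2 = s2 * \<iota> d"
    using assms unfolding cmp_def signed_def if_True by blast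
  have s2: "s2 = s1 * \<iota> a * inverse (\<iota> b)" "s2 = s1 * \<iota> c * inverse (\<iota> d)"
    using t by (metis U.right_inverse mult.assoc mult_1_right)+
  have eq: "product (Suc 1) ((\<lambda>_. a)(1 := b)) = product (Suc 1) ((\<lambda>_. c)(1 := d))"
    using s2 by (simp add: signed_def mult.assoc) (metis U.left_cancel)
  obtain q x x' e where
    "product 1 q = product 1 ((\<lambda>_. a)(1 := b)) * signed False x" "((\<lambda>_. a)(1 := b)) 1 = smul False x e"
    "product 1 q = product 1 ((\<lambda>_. c)(1 := d)) * signed False x'" "((\<lambda>_. c)(1 := d)) 1 = smul False x' e"
    by (rule product_eqE[OF eq]) simp
  then have q: "\<iota> (q 0) = \<iota> a * inverse (\<iota> x)" "\<iota> (q 0) = \<iota> c * inverse (\<iota> x')" and b: "b = e * x"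
    by (simp_all add: signed_def smul_def)
  have "t1 = s1 * \<iota> (q 0) * \<iota> x"
    by (simp add: q(1) t(1) mult.assoc)
  moreover have "t2 = s1 * \<iota> (q 0) * \<iota> x'"
    by (simp add: q(2) t(3) mult.assoc)
  moreover have "s1 * \<iota> (q 0) = s2 * \<iota> e"
    by (simp add: s2(1) q(1) b \<iota>_mult U.inverse_distrib_swap mult.assoc)
  ultimately show ?thesis
    using that[of "s1 * \<iota> (q 0)"] unfolding cmp_True_iff by blast
qed


section \<open>Peeling off a layer of diamonds\<close>

text \<open>
  One walks from \<open>w\<close> back to \<open>1\<close>, choosing \<open>v j\<close> among the endpoints of zigzags of length \<open>j\<close>, by
  applying directedness to \<open>v (Suc j)\<close> and \<open>u (Suc j)\<close>, which are both bounded by \<open>u (Suc (Suc j))\<close>.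
\<close>

lemma half_peel:
  fixes u :: "nat \<Rightarrow> 'a enveloping_group"
  assumes "zigzag (Suc d) u" "w \<in> range (product d)" "cmp (odd d) (u (Suc d)) w"
  obtains v where "zigzag d v" "v d = w" "\<And>j. j \<le> d \<Longrightarrow> cmp (odd j) (u (Suc j)) (v j)"
  using assms
proof (induction d arbitrary: w thesis)
  case 0
  then show ?case
    by (intro "0.prems"(1)[of "\<lambda>_. w"]) (auto simp: zigzag_def)
next
  case (Suc d)
  have u: "zigzag (Suc d) u" "cmp (odd d) (u (Suc d)) (u (Suc (Suc d)))"
    using zigzag_mono[OF Suc.prems(2)] zigzagD(2)[OF Suc.prems(2), of "Suc d"] by simp_all
  have "u (Suc d) \<in> range (product (Suc d))"
    using u(1) by (rule zigzag_range_product)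
  moreover have "cmp (odd d) w (u (Suc (Suc d)))"
    using Suc.prems(4) by simp
  ultimately obtain r where r: "r \<in> range (product d)" "cmp (odd d) (u (Suc d)) r" "cmp (odd d) w r"
    using range_product_directed[OF _ Suc.prems(3) u(2)] by metis
  obtain v where v: "zigzag d v" "v d = r" "\<And>j. j \<le> d \<Longrightarrow> cmp (odd j) (u (Suc j)) (v j)"
    using Suc.IH[OF _ u(1) r(1,2)] by blast
  have "cmp (even d) r w"
    using r(3) by simp
  then have "zigzag (Suc d) (v(Suc d := w))"
    using v(1,2) by (auto simp: zigzag_def less_Suc_eq)
  moreover have "cmp (odd j) (u (Suc j)) ((v(Suc d := w)) j)" if "j \<le> Suc d" for j
    using that v(3) Suc.prems(4) by (auto simp: le_Suc_eq)
  ultimately show ?case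
    by (rule Suc.prems(1)[OF _ fun_upd_same])
qed

text \<open>The right half is peeled like the left one after reversing \<open>u\<close>. Both walks
  start at \<open>u d\<close>, next to the middle vertex \<open>u (Suc d)\<close>, so they fit
  together.\<close>

lemma peel:
  fixes u :: "nat \<Rightarrow> 'a enveloping_group"
  assumes "zigzag (2 * Suc d) u" "u (2 * Suc d) = 1"
  obtains v where "zigzag (2 * d) v" "v (2 * d) = 1"
    "\<And>k. k \<le> 2 * d \<Longrightarrow> cmp (odd k) (u (Suc k)) (v k)"
proof -
  define u' where "u' i = u (2 * Suc d - i)" for i
  have u': "zigzag (2 * Suc d) u'"
    unfolding zigzag_def
  proof (intro conjI allI impI)
    show "u' 0 = 1"
      using assms(2) by (simp add: u'_def)
    show "cmp (even i) (u' i) (u' (Suc i))" if i: "i < 2 * Suc d" for i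
    proof -
      obtain j where j: "2 * Suc d = Suc (i + j)"
        using less_imp_Suc_add[OF i] by blast
      then have "cmp (even j) (u j) (u (Suc j))"
        using assms(1) by (simp add: zigzag_def)
      moreover have "even i \<longleftrightarrow> odd j"
        using arg_cong[OF j, of even] by simp
      ultimately show ?thesis
        unfolding u'_def j by simp
    qed
  qed
  have sub: "zigzag (Suc d) u" "zigzag (Suc d) u'" "zigzag d u" "cmp (even d) (u d) (u (Suc d))"
    using zigzag_mono[OF assms(1)] zigzag_mono[OF u'] zigzagD(2)[OF assms(1), of d] by simp_all
  have mid: "u d \<in> range (product d)" "cmp (odd d) (u (Suc d)) (u d)"
    using zigzag_range_product[OF sub(3)] sub(4) by simp_all
  obtain l where l: "zigzag d l" "l d = u d" "\<And>j. j \<le> d \<Longrightarrow> cmp (odd j) (u (Suc j)) (l j)"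
    using half_peel[OF sub(1) mid] by blast
  have "u' (Suc d) = u (Suc d)"
    by (simp add: u'_def)
  then obtain r where r: "zigzag d r" "r d = u d" "\<And>j. j \<le> d \<Longrightarrow> cmp (odd j) (u' (Suc j)) (r j)"
    using half_peel[OF sub(2) mid(1)] mid(2) by metis
  \<comment> \<open>At \<open>k = d\<close> both branches give \<open>u d\<close>.\<close>
  define v where "v k = (if k \<le> d then l k else r (2 * d - k))" for k
  have v_right: "v k = r (2 * d - k)" if "d \<le> k" for k
    using that l(2) r(2) by (auto simp: v_def)
  have "zigzag (2 * d) v"
    unfolding zigzag_def
  proof (intro conjI allI impI)
    show "v 0 = 1"
      using l(1) by (simp add: v_def zigzag_def)
    show "cmp (even i) (v i) (v (Suc i))" if i: "i < 2 * d" for i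
    proof (cases "i < d")
      case True
      then show ?thesis
        using l(1) by (simp add: v_def zigzag_def)
    next
      case False
      obtain j where j: "2 * d = Suc (i + j)"
        using less_imp_Suc_add[OF i] by blast
      then have "cmp (even j) (r j) (r (Suc j))"
        using r(1) False by (simp add: zigzag_def)
      moreover have "even i \<longleftrightarrow> odd j"
        using arg_cong[OF j, of even] by simp
      moreover have "v i = r (Suc j)" "v (Suc i) = r j"
        using False j by (simp_all add: v_right)
      ultimately show ?thesis
        by simp
    qed
  qed
  moreover have "v (2 * d) = 1"
    using r(1) by (simp add: v_right zigzag_def)
  moreover have "cmp (odd k) (u (Suc k)) (v k)" if k: "k \<le> 2 * d" for k
  proof (cases "k \<le> d")
    case True
    then show ?thesis
      using l(3) by (simp add: v_def)
  next
    case False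
    obtain j where j: "2 * d = k + j"
      using le_Suc_ex[OF k] by blast
    then have "cmp (odd j) (u' (Suc j)) (r j)"
      using r(3) False by simp
    moreover have "u' (Suc j) = u (Suc k)" "v k = r j"
      using False j by (simp_all add: u'_def v_right)
    moreover have "odd j \<longleftrightarrow> odd k"
      using arg_cong[OF j, of even] by simp
    ultimately show ?thesis
      by simp
  qed
  ultimately show ?thesis
    using that by blast
qed

end

section \<open>Van Kampen diagrams\<close>

definition placement :: "nat \<Rightarrow> (nat \<Rightarrow> 'a::monoid_mult enveloping_group) \<Rightarrow> (vertex \<Rightarrow> 'a enveloping_group) \<Rightarrow> bool" where
  "placement n u h \<longleftrightarrow> (\<forall>i\<le>n. h (boundary n i) = u i) \<and>
     (\<forall>(S, x, T)\<in>diamonds n. (\<forall>s\<in>S. cmp True (h s) (h x)) \<and> (\<forall>t\<in>T. cmp True (h x) (h t)))"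

text \<open>Allows a placement of the inner graph to be kept while the new boundary and centres
  receive values.\<close>

lemma diamonds_fresh:
  assumes "(S, x, T) \<in> diamonds n" "p \<in> S \<or> p = x \<or> p \<in> T" "n < m"
  shows "p \<noteq> Outer m i" "p \<noteq> Centre m i"
proof -
  have "p \<noteq> Outer m i \<and> p \<noteq> Centre m i"
    using assms
  proof (induction n arbitrary: S x T rule: diamonds.induct)
    case (1 n)
    show ?case
    proof (cases "n < 4 \<or> n = 4")
      case True
      then show ?thesis
        using "1.prems" by (subst (asm) diamonds.simps) (auto simp: boundary_def split: if_splits)
    next
      case False
      then have "(S, x, T) \<in> diamonds (n - 2) \<or> (S, x, T) \<in> attached_diamond n ` {1..n - 2}"
        using "1.prems"(1) by (subst (asm) diamonds.simps) simp
      then show ?thesis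
      proof
        assume "(S, x, T) \<in> diamonds (n - 2)"
        then show ?thesis
          using "1.IH" False "1.prems" by simp
      next
        assume "(S, x, T) \<in> attached_diamond n ` {1..n - 2}"
        then show ?thesis
          using "1.prems"(2,3) by (auto simp: attached_diamond_def boundary_def Let_def split: if_splits)
      qed
    qed
  qed
  then show "p \<noteq> Outer m i" "p \<noteq> Centre m i"
    by auto
qed

context
  assumes ore: "three_Ore TYPE('a::gcd_monoid)"
begin

lemma placement_4:
  fixes u :: "nat \<Rightarrow> 'a enveloping_group"
  assumes "zigzag 4 u" "u 4 = 1"
  shows "\<exists>h. placement 4 u h"
proof -
  have u: "u 0 = 1" "cmp (even 0) (u 0) (u 1)" "cmp (even 1) (u 1) (u 2)" "cmp (even 2) (u 2) (u 3)"
    "cmp (even 3) (u 3) (u 4)"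
    using zigzagD(1)[OF assms(1)] zigzagD(2)[OF assms(1), of 0] zigzagD(2)[OF assms(1), of 1]
      zigzagD(2)[OF assms(1), of 2] zigzagD(2)[OF assms(1), of 3]
    by (simp_all flip: numeral_2_eq_2)
  then obtain x where x: "cmp True (u 0) x" "cmp True (u 2) x" "cmp True x (u 1)" "cmp True x (u 3)"
    using interpolation[OF ore, of "u 0" "u 1" "u 3" "u 2"] assms(2) by auto
  define h where "h p = (case p of Base \<Rightarrow> 1 | Outer _ i \<Rightarrow> u i | Centre _ _ \<Rightarrow> x)" for p
  have "h (boundary 4 i) = u i" if "i \<le> 4" for i
    using that u(1) assms(2) by (auto simp: h_def boundary_def le_less)
  then have "placement 4 u h"
    using x u(1) by (subst placement_def, subst diamonds.simps) (auto simp: h_def boundary_def)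
  then show ?thesis
    by blast
qed

lemma placement_step:
  fixes u v :: "nat \<Rightarrow> 'a enveloping_group"
  assumes n: "6 \<le> n" "even n"
    and u: "zigzag n u" "u n = 1" and v: "zigzag (n - 2) v" "v (n - 2) = 1"
    and uv: "\<And>k. k \<le> n - 2 \<Longrightarrow> cmp (odd k) (u (Suc k)) (v k)"
    and g: "placement (n - 2) v g"
  shows "\<exists>h. placement n u h"
proof -
  have "\<exists>x. if even k then cmp True (u k) x \<and> cmp True (v k) x \<and>
        cmp True x (u (k + 1)) \<and> cmp True x (v (k - 1))
      else cmp True (u (k + 1)) x \<and> cmp True (v (k - 1)) x \<and> cmp True x (u k) \<and> cmp True x (v k)"
    if k: "k \<in> {1..n - 2}" for k
  proof -
    obtain j where j: "k = Suc j"
      using k by (cases k) auto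
    \<comment> \<open>The four sides of the \<open>k\<close>th copy: one on each zigzag and two
      connecting edges from \<open>uv\<close>.\<close>
    have "cmp (even k) (u k) (u (k + 1))" "cmp (odd k) (u (k + 1)) (v k)" "cmp (even k) (u k) (v (k - 1))"
      "cmp (odd k) (v (k - 1)) (v k)"
      using zigzagD(2)[OF u(1), of k] zigzagD(2)[OF v(1), of j] uv[of k] uv[of j] k n(1)
      by (simp_all add: j)
    then show ?thesis
      using interpolation[OF ore, of "u k" "u (k + 1)" "v (k - 1)" "v k"]
        interpolation[OF ore, of "u (k + 1)" "u k" "v k" "v (k - 1)"]
      by (cases "even k") (simp_all, blast+)
  qed
  then obtain X where X: "\<And>k. k \<in> {1..n - 2} \<Longrightarrow>
      if even k then cmp True (u k) (X k) \<and> cmp True (v k) (X k) \<and>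
        cmp True (X k) (u (k + 1)) \<and> cmp True (X k) (v (k - 1))
      else cmp True (u (k + 1)) (X k) \<and> cmp True (v (k - 1)) (X k) \<and>
        cmp True (X k) (u k) \<and> cmp True (X k) (v k)"
    by metis
  define h where "h p = (case p of Base \<Rightarrow> 1 | Outer m i \<Rightarrow> if m = n then u i else g p
    | Centre m i \<Rightarrow> if m = n then X i else g p)" for p
  have g_Base: "g Base = 1"
    using g v(1) by (auto simp: placement_def boundary_def zigzag_def)
  have hu: "h (boundary n i) = u i" if "i \<le> n" for i
    using that u by (auto simp: h_def boundary_def le_less zigzag_def)
  have hg: "h p = g p" if "\<And>i. p \<noteq> Outer n i \<and> p \<noteq> Centre n i" for p
    using that g_Base by (auto simp: h_def split: vertex.split)
  have hv: "h (boundary (n - 2) i) = v i" if "i \<le> n - 2" for i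
  proof -
    have "h (boundary (n - 2) i) = g (boundary (n - 2) i)"
      using n(1) by (intro hg) (auto simp: boundary_def)
    then show ?thesis
      using g that by (simp add: placement_def)
  qed
  have hX: "h (Centre n k) = X k" for k
    by (simp add: h_def)
  have "(\<forall>s\<in>S. cmp True (h s) (h x)) \<and> (\<forall>t\<in>T. cmp True (h x) (h t))"
    if "(S, x, T) \<in> diamonds n" for S x T
  proof -
    have "(S, x, T) \<in> diamonds (n - 2) \<or> (\<exists>k\<in>{1..n - 2}. (S, x, T) = attached_diamond n k)"
      using that n(1) by (subst (asm) diamonds.simps) auto
    then show ?thesis
    proof
      assume D: "(S, x, T) \<in> diamonds (n - 2)"
      have "h p = g p" if "p \<in> S \<or> p = x \<or> p \<in> T" for p
        using diamonds_fresh[OF D that, of n] n(1) by (intro hg) simp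
      then show ?thesis
        using g D by (auto simp: placement_def)
    next
      assume "\<exists>k\<in>{1..n - 2}. (S, x, T) = attached_diamond n k"
      then obtain k where k: "k \<in> {1..n - 2}" and D: "(S, x, T) = attached_diamond n k"
        by blast
      have "h (boundary n k) = u k" "h (boundary n (k + 1)) = u (k + 1)"
        "h (boundary (n - 2) k) = v k" "h (boundary (n - 2) (k - 1)) = v (k - 1)"
        using k n(1) by (auto intro!: hu hv)
      with X[OF k] D hX show ?thesis
        by (cases "even k") (auto simp: attached_diamond_def Let_def)
    qed
  qed
  then have "placement n u h"
    using hu by (auto simp: placement_def)
  then show ?thesis
    by blast
qed

lemma placement_exists:
  fixes u :: "nat \<Rightarrow> 'a enveloping_group"
  assumes "2 \<le> m" "zigzag (2 * m) u" "u (2 * m) = 1"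
  shows "\<exists>h. placement (2 * m) u h"
  using assms
proof (induction m arbitrary: u rule: nat_induct_at_least)
  case base
  then show ?case
    using placement_4 by simp
next
  case (Suc m)
  obtain v where v: "zigzag (2 * m) v" "v (2 * m) = 1"
    "\<And>k. k \<le> 2 * m \<Longrightarrow> cmp (odd k) (u (Suc k)) (v k)"
    using peel[OF ore Suc.prems] by blast
  obtain g where "placement (2 * m) v g"
    using Suc.IH[OF v(1,2)] by blast
  then show ?case
    using placement_step[of "2 * Suc m" u v g] Suc.hyps Suc.prems v by simp
qed

end

lemma boundary_arc_in_arcs:
  assumes "4 \<le> n" "even n" "i \<in> {1..n}"
  shows "boundary_arc n i \<in> arcs n"
proof (cases "n = 4")
  case True
  then have "i = 1 \<or> i = 2 \<or> i = 3 \<or> i = 4"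
    using assms(3) by auto
  moreover have "diamonds 4 =
      {({boundary 4 0, boundary 4 2}, Centre 4 1, {boundary 4 1, boundary 4 3})}"
    by (subst diamonds.simps) simp
  ultimately show ?thesis
    using True by (auto simp: arcs_def boundary_arc_def boundary_def)
next
  case False
  with assms have n: "6 \<le> n"
    by (cases "n = 5") auto
  have "\<exists>k\<in>{1..n - 2}. case attached_diamond n k of (S, x, T) \<Rightarrow> boundary_arc n i \<in> S \<times> T"
  proof -
    \<comment> \<open>A general arc lies in copy \<open>i - 1\<close>. The two arcs at
      \<open>*\<close> differ, as \<open>*\<close> is a corner of the new copies only as
      \<open>v 0\<close> or \<open>v (n - 2)\<close>.\<close>
    consider "i = 1" | "i = n" | "2 \<le> i" "i < n"
      using assms(3) by fastforce
    then show ?thesis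
    proof cases
      case 1
      then show ?thesis
        using n by (intro bexI[of _ 1])
          (auto simp: attached_diamond_def boundary_arc_def boundary_def Let_def)
    next
      case 2
      then show ?thesis
        using n assms(2) by (intro bexI[of _ "n - 2"])
          (auto simp: attached_diamond_def boundary_arc_def boundary_def Let_def)
    next
      case 3
      then show ?thesis
        by (intro bexI[of _ "i - 1"]) (auto simp: attached_diamond_def boundary_arc_def Let_def)
    qed
  qed
  then obtain k where k: "k \<in> {1..n - 2}"
    and arc': "case attached_diamond n k of (S, x, T) \<Rightarrow> boundary_arc n i \<in> S \<times> T"
    by (rule bexE)
  obtain S x T where D: "attached_diamond n k = (S, x, T)"
    by (cases "attached_diamond n k")
  with arc' have arc: "boundary_arc n i \<in> S \<times> T"
    by simp
  have "attached_diamond n k \<in> diamonds n"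
    using n imageI[OF k, of "attached_diamond n"] by (subst diamonds.simps) simp
  then have "(S, x, T) \<in> diamonds n"
    by (simp only: D)
  then show ?thesis
    unfolding arcs_def by (rule UN_I) (use arc in simp)
qed

theorem proposition6p11:
  fixes a :: "'a::gcd_monoid list" and n :: nat
  assumes "noetherian TYPE('a)"
    and "three_Ore TYPE('a)"
    and "4 \<le> n" and "even n"
    and "length a = n"
    and "unital a"
  shows "admits_van_kampen_diagram n a"
proof -
  note ore = assms(2)
  obtain m where m: "n = 2 * m" "2 \<le> m"
    using assms(3,4) by auto
  define u where "u i = product i ((!) a)" for i
  have "zigzag n u"
    by (auto simp: zigzag_def u_def cmp_mult)
  moreover have "u n = 1"
    using assms(5,6) by (simp add: u_def unital_product)
  ultimately obtain h where h: "placement n u h"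
    using placement_exists[OF ore m(2), of u] m(1) by auto
  \<comment> \<open>On arcs the quotient exists by the placement; it is unique by cancellation and
    injectivity of \<open>\<iota>\<close>.\<close>
  define label where "label = (\<lambda>(p, q). THE x. h q = h p * \<iota> x)"
  have label: "label (p, q) = x" if "h q = h p * \<iota> x" for p q x
    unfolding label_def prod.case using that
    by (intro the_equality) (simp_all add: U.left_cancel inj_\<iota>[OF ore])
  define l where "l = restrict label (arcs n)"
  have l: "l e = label e" if "e \<in> arcs n" for e
    using that by (simp add: l_def)
  have "l (boundary_arc n i) = a ! (i - 1)" if i: "i \<in> {1..n}" for i
  proof -
    obtain j where j: "i = Suc j"
      using i by (cases i) auto
    have hb: "h (boundary n i) = u (Suc j)" "h (boundary n (i - 1)) = u j"
      using h i j by (auto simp: placement_def)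
    have "label (boundary_arc n i) = a ! j"
    proof (cases "even j")
      case True
      then have "u (Suc j) = u j * \<iota> (a ! j)"
        by (simp add: u_def signed_def)
      then show ?thesis
        using label[of "boundary n i" "boundary n (i - 1)"] True hb
        by (simp add: boundary_arc_def j)
    next
      case False
      then have "u j = u (Suc j) * \<iota> (a ! j)"
        by (simp add: u_def signed_def mult.assoc)
      then show ?thesis
        using label[of "boundary n (i - 1)" "boundary n i"] False hb
        by (simp add: boundary_arc_def j)
    qed
    then show ?thesis
      using boundary_arc_in_arcs[OF assms(3,4) i] j l by simp
  qed
  moreover have "l (s, t) = l (s, x) * l (x, t)" if tri: "(s, x, t) \<in> triangles n" for s x t
  proof -
    obtain S T where D: "(S, x, T) \<in> diamonds n" "s \<in> S" "t \<in> T"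
      using tri unfolding triangles_def by auto
    then have "(s, x) \<in> arcs n" "(x, t) \<in> arcs n" "(s, t) \<in> arcs n"
      unfolding arcs_def by blast+
    moreover have "cmp True (h s) (h x)" "cmp True (h x) (h t)"
      using h D by (auto simp: placement_def)
    then obtain b c where bc: "h x = h s * \<iota> b" "h t = h x * \<iota> c"
      by (auto simp: cmp_def signed_def)
    moreover have "h t = h s * \<iota> (b * c)"
      using bc by (simp add: \<iota>_mult mult.assoc)
    ultimately show ?thesis
      by (simp add: l label)
  qed
  moreover have "l \<in> arcs n \<rightarrow>\<^sub>E UNIV"
    by (simp add: l_def)
  ultimately have "van_kampen_diagram n a l"
    unfolding van_kampen_diagram_def by auto
  then show ?thesis
    unfolding admits_van_kampen_diagram_def by blast
qed

end
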